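(* Let $X$ be a reflexive Banach space (real or complex) of dimension larger than $1$, let $T : X \to X$ be a bounded linear operator, and let $A$ be any closed ball of $X$ (with arbitrary center). Then at least one of the following holds: (1) there exists $v \in A$ such that $Tv = 0$; (2) there exists $v \in A$ such that $\overline{\mathrm{Span}}\,\mathrm{Orb}_T(Tv)$ is a non-trivial invariant subspace of $T$; (3) for every sequence $(x_n)_{n\in\mathbb{N}} \in A^{\mathbb{N}}$, $$A \subseteq \overline{\mathrm{Span}}\,\{T^k x_\ell : \ell \in \mathbb{N},\ 1\le k\le \ell\}.$$
   Context: $\mathbb{N}=\{1,2,3,\dots\}$. For $x\in X$, $\mathrm{Orb}_T(x)=\{T^n x : n\in\mathbb{N}\cup\{0\}\}$ is the orbit of $x$ under $T$. $\overline{\mathrm{Span}}\,S$ denotes the norm-closed linear span of a set $S\subseteq X$. A closed linear subspace $Y$ of $X$ is an invariant subspace of $T$ if $T(Y)\subseteq Y$; it is non-trivial if $\{0\}\subsetneq Y\subsetneq X$. *)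

theory Defs
  imports "HOL-Analysis.Analysis"
begin

text \<open>
  The scalar fields: the axiom says that the field is isometrically isomorphic, over the reals,
  to the real or to the complex numbers.
\<close>

class real_or_complex = real_normed_field +
  assumes real_or_complex:
    "(\<forall>z. \<exists>a. z = a *\<^sub>R 1) \<or>
     (\<exists>i. i * i = - 1 \<and> (\<forall>z. \<exists>a b. z = a *\<^sub>R 1 + b *\<^sub>R i) \<and>
        (\<forall>a b. norm (a *\<^sub>R 1 + b *\<^sub>R i) = sqrt (a\<^sup>2 + b\<^sup>2)))"

instance real :: real_or_complex
  by standard auto

instance complex :: real_or_complex
proof
  have "\<exists>a b. z = a *\<^sub>R 1 + b *\<^sub>R \<i>" for z
    by (rule exI[of _ "Re z"], rule exI[of _ "Im z"]) (simp add: complex_eq_iff)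
  moreover have "norm (a *\<^sub>R 1 + b *\<^sub>R \<i>) = sqrt (a\<^sup>2 + b\<^sup>2)" for a b
    by (simp add: cmod_def)
  ultimately show "(\<forall>z::complex. \<exists>a. z = a *\<^sub>R 1) \<or>
     (\<exists>i::complex. i * i = - 1 \<and> (\<forall>z. \<exists>a b. z = a *\<^sub>R 1 + b *\<^sub>R i) \<and>
        (\<forall>a b. norm (a *\<^sub>R 1 + b *\<^sub>R i) = sqrt (a\<^sup>2 + b\<^sup>2)))"
    by (intro disjI2 exI[of _ \<i>]) auto
qed

text \<open>
  A Banach space over \<open>'k\<close> is a type of class \<^class>\<open>banach\<close> (which supplies addition, the
  complete norm and the multiplication by real scalars) together with a scalar multiplication
  by \<open>'k\<close> that extends the real one and for which the norm is absolutely homogeneous.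
\<close>

locale banach_space_over = vector_space smul
  for smul :: "'k::real_or_complex \<Rightarrow> 'a::banach \<Rightarrow> 'a" +
  assumes smul_of_real: "smul (of_real r) x = r *\<^sub>R x"
    and norm_smul: "norm (smul c x) = norm c * norm x"

lemma banach_space_over_real:
  "banach_space_over (scaleR :: real \<Rightarrow> 'a::banach \<Rightarrow> 'a)"
  by unfold_locales (auto simp: algebra_simps)

lemma banach_space_over_complex:
  "banach_space_over ((*) :: complex \<Rightarrow> complex \<Rightarrow> complex)"
  by unfold_locales (auto simp: algebra_simps norm_mult scaleR_conv_of_real)

text \<open>
  Cardinality of a Hamel basis; the library's \<open>dim\<close> is \<open>0\<close> on infinite-dimensional spaces.
\<close>

definition dim_gt_one :: "('k::real_or_complex \<Rightarrow> 'a::banach \<Rightarrow> 'a) \<Rightarrow> bool" where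
  "dim_gt_one smul \<longleftrightarrow>
     (\<exists>B. \<not> module.dependent smul B \<and> module.span smul B = UNIV \<and>
          (infinite B \<or> 1 < card B))"

definition bounded_linear_over ::
  "('k::real_or_complex \<Rightarrow> 'a::real_normed_vector \<Rightarrow> 'a) \<Rightarrow>
   ('k \<Rightarrow> 'b::real_normed_vector \<Rightarrow> 'b) \<Rightarrow> ('a \<Rightarrow> 'b) \<Rightarrow> bool" where
  "bounded_linear_over smul1 smul2 f \<longleftrightarrow>
     Vector_Spaces.linear smul1 smul2 f \<and> bounded_linear f"

definition dual_space ::
  "('k::real_or_complex \<Rightarrow> 'a::banach \<Rightarrow> 'a) \<Rightarrow> ('a \<Rightarrow> 'k) set" where
  "dual_space smul = {f. bounded_linear_over smul (*) f}"

text \<open>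
  Elements of the bidual are represented by functions that are linear and bounded, with respect
  to the operator norm, on the dual space; their values outside of it are irrelevant.
\<close>

definition bidual_space ::
  "('k::real_or_complex \<Rightarrow> 'a::banach \<Rightarrow> 'a) \<Rightarrow> (('a \<Rightarrow> 'k) \<Rightarrow> 'k) set" where
  "bidual_space smul = {\<phi>.
     (\<forall>f\<in>dual_space smul. \<forall>g\<in>dual_space smul. \<phi> (\<lambda>x. f x + g x) = \<phi> f + \<phi> g) \<and>
     (\<forall>c. \<forall>f\<in>dual_space smul. \<phi> (\<lambda>x. c * f x) = c * \<phi> f) \<and>
     (\<exists>K. \<forall>f\<in>dual_space smul. norm (\<phi> f) \<le> K * onorm f)}"

text \<open>Surjectivity of the canonical map into the bidual.\<close>

definition reflexive :: "('k::real_or_complex \<Rightarrow> 'a::banach \<Rightarrow> 'a) \<Rightarrow> bool" where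
  "reflexive smul \<longleftrightarrow>
     (\<forall>\<phi>\<in>bidual_space smul. \<exists>x. \<forall>f\<in>dual_space smul. \<phi> f = f x)"

definition orbit :: "('a \<Rightarrow> 'a) \<Rightarrow> 'a \<Rightarrow> 'a set" where
  "orbit T x = {(T ^^ n) x | n. True}"

definition closed_span ::
  "('k::real_or_complex \<Rightarrow> 'a::banach \<Rightarrow> 'a) \<Rightarrow> 'a set \<Rightarrow> 'a set" where
  "closed_span smul S = closure (module.span smul S)"

definition invariant_subspace ::
  "('k::real_or_complex \<Rightarrow> 'a::banach \<Rightarrow> 'a) \<Rightarrow> ('a \<Rightarrow> 'a) \<Rightarrow> 'a set \<Rightarrow> bool" where
  "invariant_subspace smul T Y \<longleftrightarrow>
     module.subspace smul Y \<and> closed Y \<and> T ` Y \<subseteq> Y"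

definition nontrivial_invariant_subspace ::
  "('k::real_or_complex \<Rightarrow> 'a::banach \<Rightarrow> 'a) \<Rightarrow> ('a \<Rightarrow> 'a) \<Rightarrow> 'a set \<Rightarrow> bool" where
  "nontrivial_invariant_subspace smul T Y \<longleftrightarrow>
     invariant_subspace smul T Y \<and> {0} \<subset> Y \<and> Y \<subset> UNIV"

end

theory Submission
  imports Defs
begin

text \<open>
  Suppose that neither of the first two alternatives holds. For \<open>v \<in> A\<close> the space
  \<open>closed_span smul (orbit T (T v))\<close> is closed, invariant and contains \<open>T v \<noteq> 0\<close>, so it is the
  whole space: the orbit of \<open>T v\<close> spans a dense subspace for every \<open>v\<close> in the ball. Now let
  \<open>x\<close> be a sequence in \<open>A\<close>, let \<open>S\<close> be the closed span of the vectors \<open>T\<^sup>k x\<^sub>l\<close>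
  with \<open>1 \<le> k \<le> l\<close>, and suppose that \<open>S\<close> is not the whole space. By Hahn-Banach
  (\<open>separating_functional\<close>) some bounded functional \<open>f \<noteq> 0\<close> vanishes on \<open>S\<close>. As the space is
  reflexive, the ball is weakly compact, and \<open>x\<close> has a weak cluster point \<open>y \<in> A\<close>
  (\<open>weak_cluster_point\<close>). For fixed \<open>k \<ge> 1\<close> the functional \<open>f \<circ> T\<^sup>k\<close> vanishes at
  all \<open>x\<^sub>l\<close> with \<open>l \<ge> k\<close>, hence at \<open>y\<close>. So \<open>f\<close> vanishes on the orbit of \<open>T y\<close>, whose
  span is dense, which contradicts \<open>f \<noteq> 0\<close>.

  Hahn-Banach comes from sublinear functionals that are minimal in the pointwise order: these
  exist by Zorn's lemma and are linear. The weak cluster point comes from Tychonoff's theorem: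
  a bounded sequence, regarded as a sequence of scalar-valued functions on the dual space, has a
  pointwise cluster point, and this is an element of the bidual, hence given by a vector.
\<close>

section \<open>Minimal sublinear functionals\<close>

definition sublinear :: "('a::real_vector \<Rightarrow> real) \<Rightarrow> bool" where
  "sublinear p \<longleftrightarrow> (\<forall>x y. p (x + y) \<le> p x + p y) \<and> (\<forall>t\<ge>0. \<forall>x. p (t *\<^sub>R x) = t * p x)"

lemma sublinear_add: "sublinear p \<Longrightarrow> p (x + y) \<le> p x + p y"
  by (auto simp: sublinear_def)

lemma sublinear_scale: "sublinear p \<Longrightarrow> 0 \<le> t \<Longrightarrow> p (t *\<^sub>R x) = t * p x"
  by (auto simp: sublinear_def)

lemma sublinear_zero: "sublinear p \<Longrightarrow> p 0 = 0"
  using sublinear_scale[of p 0 0] by simp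

lemma sublinear_minus_ge: "sublinear p \<Longrightarrow> - p (- x) \<le> p x"
  using sublinear_add[of p x "- x"] sublinear_zero[of p] by simp

text \<open>
  One inequality suffices for homogeneity: the opposite one is the same inequality for the
  factor \<open>1 / t\<close>.
\<close>

lemma sublinearI:
  assumes add: "\<And>x y. p (x + y) \<le> p x + p y"
    and scale: "\<And>t x. 0 < t \<Longrightarrow> p (t *\<^sub>R x) \<le> t * p x"
  shows "sublinear p"
proof -
  have eq: "p (t *\<^sub>R x) = t * p x" if "0 < t" for t x
  proof (rule antisym)
    have "p x \<le> (1 / t) * p (t *\<^sub>R x)"
      using scale[of "1 / t" "t *\<^sub>R x"] that by simp
    then show "t * p x \<le> p (t *\<^sub>R x)"
      using that by (simp add: field_simps)
  qed (use scale that in blast)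
  have "p 0 = 0"
    using eq[of 2 0] by simp
  then show ?thesis
    unfolding sublinear_def using add eq by (metis less_eq_real_def mult_zero_left scaleR_zero_left)
qed

text \<open>
  Zorn's lemma applies because the infimum of a chain is again sublinear. It is finite, since
  every sublinear \<open>q \<le> p\<close> satisfies \<open>q x \<ge> - q (- x) \<ge> - p (- x)\<close>.
\<close>

lemma minimal_sublinear_below:
  fixes p :: "'a::real_vector \<Rightarrow> real"
  assumes p: "sublinear p"
  obtains q where "sublinear q" "q \<le> p" "\<And>q'. sublinear q' \<Longrightarrow> q' \<le> q \<Longrightarrow> q' = q"
proof -
  define Q where "Q = {q. sublinear q \<and> q \<le> p}"
  let ?P = "\<lambda>a b :: 'a \<Rightarrow> real. b \<le> a"
  have "\<exists>m\<in>Q. \<forall>a\<in>Q. ?P m a \<longrightarrow> a = m"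
  proof (rule predicate_Zorn)
    show "partial_order_on Q (relation_of ?P Q)"
      by (rule partial_order_on_relation_ofI) auto
  next
    fix C assume C: "C \<in> Chains (relation_of ?P Q)"
    have CQ: "C \<subseteq> Q" and total: "\<And>a b. a \<in> C \<Longrightarrow> b \<in> C \<Longrightarrow> a \<le> b \<or> b \<le> a"
      using C by (auto simp: Chains_def relation_of_def)
    show "\<exists>u\<in>Q. \<forall>a\<in>C. ?P a u"
    proof (cases "C = {}")
      case True
      then show ?thesis using p by (auto simp: Q_def)
    next
      case False
      define u where "u x = (INF q\<in>C. q x)" for x
      have bdd: "bdd_below ((\<lambda>q. q x) ` C)" for x
      proof (rule bdd_belowI2)
        fix q assume "q \<in> C"
        then have q: "sublinear q" "q (- x) \<le> p (- x)"
          using CQ by (auto simp: Q_def le_fun_def)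
        show "- p (- x) \<le> q x"
          using sublinear_minus_ge[OF q(1), of x] q(2) by linarith
      qed
      have u_le: "u x \<le> q x" if "q \<in> C" for q x
        unfolding u_def using bdd that by (rule cINF_lower)
      have u_ge: "m \<le> u x" if "\<And>q. q \<in> C \<Longrightarrow> m \<le> q x" for m x
        unfolding u_def using False that by (rule cINF_greatest)
      have "sublinear u"
      proof (rule sublinearI)
        fix x y
        \<comment> \<open>Two members of the chain are comparable, and the smaller one bounds \<open>u (x + y)\<close>.\<close>
        have two: "u (x + y) \<le> q1 x + q2 y" if q: "q1 \<in> C" "q2 \<in> C" for q1 q2
        proof -
          obtain q where "q \<in> C" "q \<le> q1" "q \<le> q2"
            using total[OF q] q by blast
          moreover from this have "q (x + y) \<le> q x + q y"
            using CQ by (auto simp: Q_def sublinear_add)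
          ultimately show ?thesis
            using u_le[of q "x + y"] by (smt (verit) le_funD)
        qed
        have "u (x + y) - q1 x \<le> u y" if "q1 \<in> C" for q1
          by (rule u_ge) (use two[OF that] in force)
        then have "u (x + y) - u y \<le> u x"
          by (intro u_ge) force
        then show "u (x + y) \<le> u x + u y" by simp
      next
        fix t :: real and x assume t: "0 < t"
        have "u (t *\<^sub>R x) / t \<le> u x"
        proof (rule u_ge)
          fix q assume q: "q \<in> C"
          then have "sublinear q" using CQ by (auto simp: Q_def)
          then show "u (t *\<^sub>R x) / t \<le> q x"
            using u_le[OF q, of "t *\<^sub>R x"] t by (simp add: sublinear_scale field_simps)
        qed
        then show "u (t *\<^sub>R x) \<le> t * u x" using t by (simp add: field_simps)
      qed
      moreover obtain q where "q \<in> C" "q \<le> p" using False CQ by (auto simp: Q_def)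
      ultimately have "u \<in> Q" using u_le[of q] by (auto simp: Q_def le_fun_def intro: order_trans)
      then show ?thesis using u_le by (auto simp: le_fun_def)
    qed
  qed
  then show ?thesis
    using that unfolding Q_def by (auto intro: order_trans)
qed

text \<open>
  For sublinear \<open>p\<close> this is the largest sublinear functional below \<open>p\<close> with value \<open>- p y\<close>
  at \<open>- y\<close>; it is linear on the line through \<open>y\<close>.
\<close>

definition straighten :: "('a::real_vector \<Rightarrow> real) \<Rightarrow> 'a \<Rightarrow> 'a \<Rightarrow> real" where
  "straighten p y x = (INF t\<in>{0..}. p (x + t *\<^sub>R y) - t * p y)"

lemma straighten_le:
  assumes "sublinear p" "0 \<le> t"
  shows "straighten p y x \<le> p (x + t *\<^sub>R y) - t * p y"
  unfolding straighten_def
proof (rule cINF_lower)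
  show "bdd_below ((\<lambda>t. p (x + t *\<^sub>R y) - t * p y) ` {0..})"
  proof (rule bdd_belowI2)
    fix s :: real assume "s \<in> {0..}"
    then show "- p (- x) \<le> p (x + s *\<^sub>R y) - s * p y"
      using sublinear_add[OF assms(1), of "x + s *\<^sub>R y" "- x"] sublinear_scale[OF assms(1), of s y]
      by simp
  qed
qed (use assms in simp)

lemma straighten_ge:
  assumes "\<And>t. 0 \<le> t \<Longrightarrow> m \<le> p (x + t *\<^sub>R y) - t * p y"
  shows "m \<le> straighten p y x"
  unfolding straighten_def by (rule cINF_greatest) (use assms in auto)

lemma sublinear_straighten:
  assumes p: "sublinear p"
  shows "sublinear (straighten p y)"
proof (rule sublinearI)
  fix x x'
  have two: "straighten p y (x + x')
      \<le> (p (x + t *\<^sub>R y) - t * p y) + (p (x' + s *\<^sub>R y) - s * p y)" if "0 \<le> t" "0 \<le> s" for s t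
  proof -
    have "straighten p y (x + x') \<le> p (x + x' + (t + s) *\<^sub>R y) - (t + s) * p y"
      using straighten_le[OF p] that by simp
    also have "x + x' + (t + s) *\<^sub>R y = (x + t *\<^sub>R y) + (x' + s *\<^sub>R y)"
      by (simp add: algebra_simps)
    finally show ?thesis
      using sublinear_add[OF p, of "x + t *\<^sub>R y" "x' + s *\<^sub>R y"] by (simp add: algebra_simps)
  qed
  have "straighten p y (x + x') - (p (x + t *\<^sub>R y) - t * p y) \<le> straighten p y x'" if "0 \<le> t" for t
    by (rule straighten_ge) (use two[OF that] in force)
  then have "straighten p y (x + x') - straighten p y x' \<le> straighten p y x"
    by (intro straighten_ge) force
  then show "straighten p y (x + x') \<le> straighten p y x + straighten p y x'" by simp
next
  fix a :: real and x assume a: "0 < a"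
  have "straighten p y (a *\<^sub>R x) / a \<le> straighten p y x"
  proof (rule straighten_ge)
    fix t :: real assume t: "0 \<le> t"
    have "straighten p y (a *\<^sub>R x) \<le> p (a *\<^sub>R x + (a * t) *\<^sub>R y) - (a * t) * p y"
      using straighten_le[OF p] a t by simp
    also have "p (a *\<^sub>R x + (a * t) *\<^sub>R y) = a * p (x + t *\<^sub>R y)"
      using sublinear_scale[OF p, of a "x + t *\<^sub>R y"] a by (simp add: scaleR_add_right)
    finally show "straighten p y (a *\<^sub>R x) / a \<le> p (x + t *\<^sub>R y) - t * p y"
      using a by (simp add: field_simps)
  qed
  then show "straighten p y (a *\<^sub>R x) \<le> a * straighten p y x"
    using a by (simp add: field_simps)
qed

text \<open>
  A minimal sublinear functional equals all its straightenings, and this is additivity.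
\<close>

lemma minimal_sublinear_is_linear:
  fixes q :: "'a::real_vector \<Rightarrow> real"
  assumes q: "sublinear q" and min: "\<And>q'. sublinear q' \<Longrightarrow> q' \<le> q \<Longrightarrow> q' = q"
  shows "linear q"
proof -
  have straight: "straighten q y = q" for y
  proof (rule min[OF sublinear_straighten[OF q]])
    show "straighten q y \<le> q"
      using straighten_le[OF q, of 0 y] by (simp add: le_fun_def)
  qed
  have add: "q (x + y) = q x + q y" for x y
    using straighten_le[OF q, of 1 y x] straight[of y] sublinear_add[OF q, of x y] by simp
  have minus: "q (- x) = - q x" for x
    using add[of x "- x"] sublinear_zero[OF q] by simp
  show ?thesis
  proof (rule linearI)
    fix t x
    show "q (t *\<^sub>R x) = t *\<^sub>R q x"
    proof (cases "0 \<le> t")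
      case False
      then show ?thesis
        using sublinear_scale[OF q, of "- t" x] minus[of "t *\<^sub>R x"] by simp
    qed (simp add: sublinear_scale[OF q])
  qed (rule add)
qed

section \<open>The Hahn-Banach theorem\<close>

text \<open>
  Straightening \<open>p\<close> at \<open>y\<close> before minimising keeps the value at \<open>y\<close>: a linear functional
  below the result is at most \<open>- p y\<close> at \<open>- y\<close>.
\<close>

lemma hahn_banach_sublinear:
  fixes p :: "'a::real_vector \<Rightarrow> real"
  assumes p: "sublinear p"
  obtains u where "linear u" "u \<le> p" "u y = p y"
proof -
  obtain u where u: "sublinear u" "u \<le> straighten p y"
    and min: "\<And>q'. sublinear q' \<Longrightarrow> q' \<le> u \<Longrightarrow> q' = u"
    using minimal_sublinear_below[OF sublinear_straighten[OF p]] by metis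
  have lin: "linear u"
    using minimal_sublinear_is_linear[OF u(1) min] .
  have le: "u x \<le> p x" for x
    using le_funD[OF u(2), of x] straighten_le[OF p, of 0 y x] by simp
  have "u (- y) \<le> - p y"
    using le_funD[OF u(2), of "- y"] straighten_le[OF p, of 1 y "- y"] sublinear_zero[OF p] by simp
  then have "u y = p y"
    using le[of y] linear_neg[OF lin, of y] by simp
  with lin le show ?thesis by (intro that[of u]) (auto simp: le_fun_def)
qed

context banach_space_over
begin

lemma linear_scalar_iff:
  "Vector_Spaces.linear smul (*) (F :: 'a \<Rightarrow> 'k) \<longleftrightarrow>
     (\<forall>x y. F (x + y) = F x + F y) \<and> (\<forall>c x. F (smul c x) = c * F x)"
proof -
  have "vector_space ((*) :: 'k \<Rightarrow> 'k \<Rightarrow> 'k)"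
    by unfold_locales (auto simp: algebra_simps)
  then show ?thesis
    by (simp add: Vector_Spaces.linear_iff vector_space_axioms)
qed

lemma dual_spaceI:
  fixes F :: "'a \<Rightarrow> 'k"
  assumes "Vector_Spaces.linear smul (*) F" and "\<And>x. norm (F x) \<le> norm x * K"
  shows "F \<in> dual_space smul"
proof -
  have F: "F (x + y) = F x + F y" "F (smul c x) = c * F x" for x y c
    using assms(1) by (auto simp: linear_scalar_iff)
  have "bounded_linear F"
  proof (rule bounded_linear_intro)
    show "F (r *\<^sub>R x) = r *\<^sub>R F x" for r x
      using F(2)[of "of_real r" x] by (simp add: smul_of_real scaleR_conv_of_real)
  qed (use F assms(2) in auto)
  then show ?thesis
    using assms(1) by (simp add: dual_space_def bounded_linear_over_def)
qed

lemma dual_spaceD: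
  assumes "f \<in> dual_space smul"
  shows "bounded_linear f" "f (x + y) = f x + f y" "f (x - y) = f x - f y" "f (smul c x) = c * f x"
  using assms linear_scalar_iff[of f] bounded_linear.linear[of f]
  by (auto simp: dual_space_def bounded_linear_over_def linear_diff)

text \<open>
  A real-linear functional is the real part of a unique linear functional over \<open>'k\<close>, which over
  the complex numbers is \<open>x \<mapsto> u x - i u (i x)\<close>. The last two conclusions express, without
  a real part on \<open>'k\<close>, that \<open>u\<close> is the real part of \<open>F\<close>.
\<close>

lemma scalar_extension_of_real_functional:
  fixes u :: "'a \<Rightarrow> real"
  assumes u: "linear u"
  obtains F :: "'a \<Rightarrow> 'k" where "Vector_Spaces.linear smul (*) F"
    and "\<And>x. u x \<le> norm (F x)" and "\<And>x w. F x = of_real w \<Longrightarrow> u x = w"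
proof -
  have u_add: "u (x + y) = u x + u y" and u_scale: "u (t *\<^sub>R x) = t * u x" for x y t
    using linear_add[OF u] linear_scale[OF u] by auto
  consider (real) "\<forall>z::'k. \<exists>a. z = a *\<^sub>R 1"
    | (complex) i :: 'k where "i * i = - 1" "\<forall>z. \<exists>a b. z = a *\<^sub>R 1 + b *\<^sub>R i"
        "\<forall>a b. norm (a *\<^sub>R 1 + b *\<^sub>R i) = sqrt (a\<^sup>2 + b\<^sup>2)"
    using real_or_complex[where 'a='k] by blast
  then show ?thesis
  proof cases
    case real
    show ?thesis
    proof (rule that[of "\<lambda>x. of_real (u x)"])
      have "of_real (u (smul c x)) = c * (of_real (u x) :: 'k)" for c x
      proof -
        obtain a where c: "c = of_real a"
          using real by (metis of_real_def)
        show ?thesis by (simp add: c smul_of_real u_scale)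
      qed
      then show "Vector_Spaces.linear smul (*) (\<lambda>x. of_real (u x) :: 'k)"
        by (simp add: linear_scalar_iff u_add)
    qed auto
  next
    case (complex i)
    define F where "F x = of_real (u x) - i * of_real (u (smul i x))" for x
    have smul_ii: "smul i (smul i x) = - x" for x
      using complex(1) by simp
    have F_norm: "norm (F x - of_real w) = sqrt ((u x - w)\<^sup>2 + (u (smul i x))\<^sup>2)" for x w
    proof -
      have "F x - of_real w = (u x - w) *\<^sub>R 1 + (- u (smul i x)) *\<^sub>R i"
        by (simp add: F_def scaleR_conv_of_real algebra_simps)
      also have "norm \<dots> = sqrt ((u x - w)\<^sup>2 + (- u (smul i x))\<^sup>2)"
        using complex(3) by blast
      finally show ?thesis by simp
    qed
    show ?thesis
    proof (rule that[of F])
      have "F (x + y) = F x + F y" for x y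
        by (simp add: F_def u_add scale_right_distrib algebra_simps)
      moreover have "F (smul z x) = z * F x" for z x
      proof -
        obtain a b where z: "z = of_real a + of_real b * i"
          using complex(2) by (metis scaleR_conv_of_real mult.right_neutral)
        have 1: "smul z x = a *\<^sub>R x + b *\<^sub>R smul i x"
          by (simp add: z scale_left_distrib smul_of_real flip: scale_scale)
        have "smul i (smul z x) = smul z (smul i x)"
          by (simp add: mult.commute)
        also have "\<dots> = a *\<^sub>R smul i x - b *\<^sub>R x"
          using smul_ii[of x]
          by (simp add: z scale_left_distrib smul_of_real del: scale_scale flip: scale_scale)
        finally have 2: "smul i (smul z x) = a *\<^sub>R smul i x + (- b) *\<^sub>R x" by simp
        have "F (smul z x) = of_real (a * u x + b * u (smul i x))
            - i * of_real (a * u (smul i x) - b * u x)"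
          unfolding F_def 2 unfolding 1 u_add u_scale by simp
        also have "\<dots> = z * F x + (1 + i * i) * (of_real b * of_real (u (smul i x)))"
          by (simp add: F_def z algebra_simps)
        finally show ?thesis using complex(1) by simp
      qed
      ultimately show "Vector_Spaces.linear smul (*) F"
        by (simp add: linear_scalar_iff)
      show "u x \<le> norm (F x)" for x
        using F_norm[of x 0] real_sqrt_sum_squares_ge1[of "u x" "u (smul i x)"] by simp
      show "u x = w" if "F x = of_real w" for x w
        using F_norm[of x w] that by (simp add: sum_power2_eq_zero_iff)
    qed
  qed
qed

lemma hahn_banach_seminorm:
  fixes p :: "'a \<Rightarrow> real"
  assumes add: "\<And>x y. p (x + y) \<le> p x + p y"
    and scale: "\<And>c x. p (smul c x) \<le> norm c * p x"
    and bound: "\<And>x. p x \<le> norm x"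
  obtains f where "f \<in> dual_space smul" "\<And>x. norm (f x) \<le> p x" "norm (f y) = p y"
proof -
  have "sublinear p"
  proof (rule sublinearI)
    show "p (t *\<^sub>R x) \<le> t * p x" if "0 < t" for t x
      using scale[of "of_real t" x] that by (simp add: smul_of_real)
  qed (rule add)
  then obtain u where u: "linear u" "u \<le> p" "u y = p y"
    using hahn_banach_sublinear by metis
  obtain F :: "'a \<Rightarrow> 'k" where F: "Vector_Spaces.linear smul (*) F"
    and F_ge: "\<And>x. u x \<le> norm (F x)" and F_real: "\<And>x w. F x = of_real w \<Longrightarrow> u x = w"
    using scalar_extension_of_real_functional[OF u(1)] by metis
  have le: "norm (F x) \<le> p x" for x
  proof (cases "F x = 0")
    case True
    then show ?thesis
      using F_real[of x 0] le_funD[OF u(2), of x] by simp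
  next
    case False
    \<comment> \<open>A rotation that makes the value at \<open>x\<close> real and nonnegative.\<close>
    define \<theta> where "\<theta> = of_real (norm (F x)) / F x"
    have "norm \<theta> = 1" using False by (simp add: \<theta>_def norm_divide)
    have "F (smul \<theta> x) = of_real (norm (F x))"
      using F False by (simp add: linear_scalar_iff \<theta>_def)
    then have "norm (F x) = u (smul \<theta> x)" using F_real by metis
    also have "\<dots> \<le> p (smul \<theta> x)" using u(2) by (simp add: le_fun_def)
    also have "\<dots> \<le> p x" using scale[of \<theta> x] \<open>norm \<theta> = 1\<close> by simp
    finally show ?thesis .
  qed
  have "F \<in> dual_space smul"
    by (rule dual_spaceI[OF F, of 1]) (use order_trans[OF le bound] in simp)
  moreover have "norm (F y) = p y"
    using le[of y] F_ge[of y] u(3) by simp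
  ultimately show ?thesis using le that by blast
qed

lemma norming_functional:
  obtains f where "f \<in> dual_space smul" "\<And>x. norm (f x) \<le> norm x" "norm (f y) = norm y"
  using hahn_banach_seminorm[of norm y] norm_triangle_ineq norm_smul by (metis order_refl)

text \<open>
  This is Hahn-Banach for the quotient seminorm modulo \<open>S\<close>, the distance to \<open>S\<close>.
\<close>

lemma separating_functional:
  assumes S: "subspace S" and z: "z \<notin> closure S"
  obtains f where "f \<in> dual_space smul" "\<And>s. s \<in> S \<Longrightarrow> f s = 0" "f z \<noteq> 0"
proof -
  have ne: "S \<noteq> {}" using subspace_0[OF S] by blast
  have approx: "\<exists>s\<in>S. dist x s < infdist x S + e" if "0 < e" for x e
  proof (rule ccontr)
    assume "\<not> ?thesis"
    then have "infdist x S + e \<le> infdist x S"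
      using ne by (subst (2) infdist_notempty) (auto intro!: cINF_greatest simp: not_less)
    then show False using that by simp
  qed
  have add: "infdist (x + y) S \<le> infdist x S + infdist y S" for x y
  proof (rule field_le_epsilon)
    fix e :: real assume "0 < e"
    then obtain s s' where s: "s \<in> S" "dist x s < infdist x S + e / 2"
        "s' \<in> S" "dist y s' < infdist y S + e / 2"
      using approx[of "e / 2" x] approx[of "e / 2" y] by auto
    have "infdist (x + y) S \<le> dist (x + y) (s + s')"
      using s S by (intro infdist_le) (simp add: subspace_add)
    also have "\<dots> \<le> dist x s + dist y s'" by (rule dist_triangle_add)
    finally show "infdist (x + y) S \<le> infdist x S + infdist y S + e" using s by simp
  qed
  have scale: "infdist (smul c x) S \<le> norm c * infdist x S" for c x
  proof (rule field_le_epsilon)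
    fix e :: real assume e: "0 < e"
    define d where "d = e / (norm c + 1)"
    have pos: "0 < norm c + 1" by (smt (verit) norm_ge_zero)
    have d: "0 < d" "norm c * d \<le> e"
      using e pos by (auto simp: d_def field_simps)
    then obtain s where s: "s \<in> S" "dist x s < infdist x S + d"
      using approx[of d x] by auto
    have "infdist (smul c x) S \<le> dist (smul c x) (smul c s)"
      using s S by (intro infdist_le) (simp add: subspace_scale)
    also have "\<dots> = norm c * dist x s"
      by (simp add: dist_norm norm_smul flip: scale_right_diff_distrib)
    also have "\<dots> \<le> norm c * (infdist x S + d)"
      using s by (intro mult_left_mono) auto
    finally show "infdist (smul c x) S \<le> norm c * infdist x S + e"
      using d by (simp add: algebra_simps)
  qed
  have bound: "infdist x S \<le> norm x" for x
    using infdist_le[OF subspace_0[OF S], of x] by simp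
  obtain f where f: "f \<in> dual_space smul" "\<And>x. norm (f x) \<le> infdist x S"
      "norm (f z) = infdist z S"
    using hahn_banach_seminorm[of "\<lambda>x. infdist x S" z] add scale bound by metis
  have "infdist z S \<noteq> 0"
    using z ne in_closure_iff_infdist_zero by blast
  then have "f z \<noteq> 0" using f(3) by auto
  moreover have "f s = 0" if "s \<in> S" for s
    using f(2)[of s] that by simp
  ultimately show ?thesis using that f(1) by blast
qed

end

section \<open>Weak cluster points in reflexive spaces\<close>

lemma compact_scalar_cball: "compact (cball (0 :: 'k::real_or_complex) M)"
proof -
  have *: "compact (cball (0::'k) M)" if "cball (0::'k) M \<subseteq> K" "compact K" for K
    using that compact_Int_closed[of K "cball 0 M"] by (simp add: Int_absorb1)
  consider (real) "\<forall>z::'k. \<exists>a. z = a *\<^sub>R 1"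
    | (complex) i :: 'k where "\<forall>z. \<exists>a b. z = a *\<^sub>R 1 + b *\<^sub>R i"
        "\<forall>a b. norm (a *\<^sub>R 1 + b *\<^sub>R i) = sqrt (a\<^sup>2 + b\<^sup>2)"
    using real_or_complex[where 'a='k] by blast
  then show ?thesis
  proof cases
    case real
    show ?thesis
    proof (rule *)
      show "compact ((\<lambda>a. a *\<^sub>R (1::'k)) ` cball 0 M)"
        by (intro compact_continuous_image continuous_intros compact_cball)
      show "cball 0 M \<subseteq> (\<lambda>a. a *\<^sub>R (1::'k)) ` cball 0 M"
      proof
        fix z :: 'k assume z: "z \<in> cball 0 M"
        obtain a where "z = a *\<^sub>R 1" using real by blast
        with z show "z \<in> (\<lambda>a. a *\<^sub>R (1::'k)) ` cball 0 M" by auto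
      qed
    qed
  next
    case (complex i)
    let ?g = "\<lambda>ab. fst ab *\<^sub>R 1 + snd ab *\<^sub>R i"
    show ?thesis
    proof (rule *)
      show "compact (?g ` (cball 0 M \<times> cball 0 M))"
        by (intro compact_continuous_image continuous_intros compact_Times compact_cball)
      show "cball 0 M \<subseteq> ?g ` (cball 0 M \<times> cball 0 M)"
      proof
        fix z :: 'k assume z: "z \<in> cball 0 M"
        obtain a b where ab: "z = a *\<^sub>R 1 + b *\<^sub>R i" using complex by blast
        then have "norm z = sqrt (a\<^sup>2 + b\<^sup>2)" using complex by blast
        then have "\<bar>a\<bar> \<le> norm z" "\<bar>b\<bar> \<le> norm z"
          by (auto intro!: real_le_rsqrt)
        then have "(a, b) \<in> cball 0 M \<times> cball 0 M" using z by auto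
        then show "z \<in> ?g ` (cball 0 M \<times> cball 0 M)"
          using ab by (intro image_eqI[of _ _ "(a, b)"]) auto
      qed
    qed
  qed
qed

text \<open>
  By Tychonoff's theorem the sequence \<open>a\<close> has a cluster point \<open>\<phi>\<close> in the product of the balls
  of radius \<open>M i\<close>. The filter \<open>G\<close> plays the role of a subnet along which \<open>a\<close> converges to
  \<open>\<phi>\<close> in every coordinate, so that the usual limit laws apply.
\<close>

lemma pointwise_cluster_point:
  fixes a :: "nat \<Rightarrow> 'i \<Rightarrow> 'k::real_or_complex"
  assumes bound: "eventually (\<lambda>n. \<forall>i. norm (a n i) \<le> M i) sequentially"
  obtains G \<phi> where "G \<noteq> bot" "G \<le> sequentially" "\<And>i. ((\<lambda>n. a n i) \<longlongrightarrow> \<phi> i) G"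
proof -
  define K where "K = (\<Pi>\<^sub>E i\<in>UNIV. cball (0::'k) (M i))"
  have "compactin (product_topology (\<lambda>i::'i. euclidean :: 'k topology) UNIV) K"
    unfolding K_def by (simp add: compactin_PiE compact_scalar_cball)
  then have "compact K"
    by (simp add: euclidean_product_topology)
  moreover have "filtermap a sequentially \<noteq> bot"
    by (simp add: filtermap_bot_iff)
  moreover have "eventually (\<lambda>f. f \<in> K) (filtermap a sequentially)"
    using bound by (auto simp: eventually_filtermap K_def PiE_UNIV_domain elim: eventually_mono)
  ultimately obtain \<phi> where \<phi>: "inf (nhds \<phi>) (filtermap a sequentially) \<noteq> bot"
    unfolding compact_filter by blast
  define G where "G = inf sequentially (filtercomap a (nhds \<phi>))"
  have "G \<noteq> bot"
  proof
    assume "G = bot"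
    then obtain Q R where "eventually Q sequentially" "eventually R (nhds \<phi>)"
      "\<And>n. Q n \<Longrightarrow> \<not> R (a n)"
      unfolding G_def trivial_limit_def eventually_inf eventually_filtercomap by metis
    then have "eventually R (nhds \<phi>)" "eventually (\<lambda>f. \<not> R f) (filtermap a sequentially)"
      by (auto simp: eventually_filtermap elim: eventually_mono)
    then have "inf (nhds \<phi>) (filtermap a sequentially) = bot"
      unfolding trivial_limit_def eventually_inf by blast
    with \<phi> show False ..
  qed
  moreover have "G \<le> sequentially" by (simp add: G_def)
  moreover have "((\<lambda>n. a n i) \<longlongrightarrow> \<phi> i) G" for i
  proof -
    have "filterlim a (nhds \<phi>) G"
      unfolding G_def by (rule filterlim_mono[OF filterlim_filtercomap]) auto
    then show ?thesis
      by (rule continuous_on_tendsto_compose[OF continuous_on_product_coordinates[of i]]) auto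
  qed
  ultimately show ?thesis using that by blast
qed

context banach_space_over
begin

text \<open>
  The pointwise limit of the evaluations at \<open>x n\<close> lies in the bidual, so by reflexivity it is
  the evaluation at a vector \<open>y\<close>. A norming functional of \<open>y - c\<close> shows that \<open>y\<close> does not
  leave the ball.
\<close>

lemma weak_cluster_point:
  fixes x :: "nat \<Rightarrow> 'a"
  assumes refl: "reflexive smul" and x: "eventually (\<lambda>n. x n \<in> cball c r) sequentially"
  obtains G y where "G \<noteq> bot" "G \<le> sequentially" "y \<in> cball c r"
    "\<And>f. f \<in> dual_space smul \<Longrightarrow> ((\<lambda>n. f (x n)) \<longlongrightarrow> f y) G"
proof -
  define R where "R = norm c + r"
  define a where "a n f = (if f \<in> dual_space smul then f (x n) else 0)" for n f
  define M where "M f = (if f \<in> dual_space smul then R * onorm f else 0)" for f :: "'a \<Rightarrow> 'k"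
  have bound: "eventually (\<lambda>n. \<forall>f. norm (a n f) \<le> M f) sequentially"
    using x
  proof (rule eventually_mono)
    fix n assume n: "x n \<in> cball c r"
    have "norm (x n) \<le> R"
      using n norm_triangle_ineq2[of "x n" c] by (simp add: R_def dist_norm norm_minus_commute)
    then have "norm (f (x n)) \<le> R * onorm f" if "f \<in> dual_space smul" for f :: "'a \<Rightarrow> 'k"
      using onorm[OF dual_spaceD(1)[OF that], of "x n"]
        mult_right_mono[OF _ onorm_pos_le[OF dual_spaceD(1)[OF that]], of "norm (x n)" R]
      by (simp add: mult.commute)
    then show "\<forall>f. norm (a n f) \<le> M f" by (simp add: a_def M_def)
  qed
  then obtain G \<phi> where G: "G \<noteq> bot" "G \<le> sequentially"
    and lim: "\<And>f. ((\<lambda>n. a n f) \<longlongrightarrow> \<phi> f) G"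
    using pointwise_cluster_point by metis
  have lim': "((\<lambda>n. f (x n)) \<longlongrightarrow> \<phi> f) G" if "f \<in> dual_space smul" for f
    using lim[of f] that by (simp add: a_def)
  have unique: "\<phi> f = l" if "f \<in> dual_space smul" "((\<lambda>n. f (x n)) \<longlongrightarrow> l) G" for f l
    using tendsto_unique[OF G(1) lim'[OF that(1)] that(2)] .
  have "\<phi> \<in> bidual_space smul"
    unfolding bidual_space_def
  proof (intro CollectI conjI ballI allI exI)
    fix f g :: "'a \<Rightarrow> 'k" assume fg: "f \<in> dual_space smul" "g \<in> dual_space smul"
    have "bounded_linear (\<lambda>x. f x + g x)"
      using fg by (intro bounded_linear_add dual_spaceD)
    then have "(\<lambda>x. f x + g x) \<in> dual_space smul"
      using fg by (simp add: dual_space_def bounded_linear_over_def linear_scalar_iff algebra_simps)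
    then show "\<phi> (\<lambda>x. f x + g x) = \<phi> f + \<phi> g"
      by (rule unique) (intro tendsto_add lim' fg)
  next
    fix k and f :: "'a \<Rightarrow> 'k" assume f: "f \<in> dual_space smul"
    have "bounded_linear (\<lambda>x. k * f x)"
      using f by (intro bounded_linear_const_mult dual_spaceD)
    then have "(\<lambda>x. k * f x) \<in> dual_space smul"
      using f by (simp add: dual_space_def bounded_linear_over_def linear_scalar_iff algebra_simps)
    then show "\<phi> (\<lambda>x. k * f x) = k * \<phi> f"
      by (rule unique) (intro tendsto_mult tendsto_const lim' f)
  next
    fix f :: "'a \<Rightarrow> 'k" assume f: "f \<in> dual_space smul"
    have "eventually (\<lambda>n. norm (f (x n)) \<le> R * onorm f) G"
      using filter_leD[OF G(2) bound] by eventually_elim (metis f a_def M_def)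
    then show "norm (\<phi> f) \<le> R * onorm f"
      by (rule tendsto_upperbound[OF tendsto_norm[OF lim'[OF f]] _ G(1)])
  qed
  then obtain y where y: "\<And>f. f \<in> dual_space smul \<Longrightarrow> \<phi> f = f y"
    using refl by (auto simp: reflexive_def)
  have weak: "((\<lambda>n. f (x n)) \<longlongrightarrow> f y) G" if "f \<in> dual_space smul" for f
    using lim'[OF that] y[OF that] by simp
  have "norm (y - c) \<le> r"
  proof -
    obtain f where f: "f \<in> dual_space smul" "\<And>x. norm (f x) \<le> norm x"
        "norm (f (y - c)) = norm (y - c)"
      using norming_functional[of "y - c"] by metis
    have "((\<lambda>n. norm (f (x n) - f c)) \<longlongrightarrow> norm (f y - f c)) G"
      by (intro tendsto_norm tendsto_diff tendsto_const weak f)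
    moreover have "eventually (\<lambda>n. norm (f (x n) - f c) \<le> r) G"
      using filter_leD[OF G(2) x]
    proof eventually_elim
      case (elim n)
      then have "norm (x n - c) \<le> r" by (simp add: dist_norm norm_minus_commute)
      then show ?case using f(2)[of "x n - c"] dual_spaceD(3)[OF f(1)] by simp
    qed
    ultimately have "norm (f y - f c) \<le> r"
      using G(1) tendsto_upperbound by blast
    then show ?thesis using f(3) dual_spaceD(3)[OF f(1)] by simp
  qed
  then have "y \<in> cball c r" by (simp add: dist_norm norm_minus_commute)
  then show ?thesis using that G weak by blast
qed

section \<open>Orbits and invariant subspaces\<close>

lemma subspace_closure:
  assumes "subspace S"
  shows "subspace (closure S)"
proof (rule subspaceI)
  show "0 \<in> closure S"
    using subspace_0[OF assms] closure_subset by blast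
next
  fix x y assume "x \<in> closure S" "y \<in> closure S"
  then obtain X Y where "\<forall>n. X n \<in> S" "X \<longlonglongrightarrow> x" "\<forall>n. Y n \<in> S" "Y \<longlonglongrightarrow> y"
    unfolding closure_sequential by blast
  then have "(\<lambda>n. X n + Y n) \<longlonglongrightarrow> x + y" "\<forall>n. X n + Y n \<in> S"
    using assms by (auto intro: tendsto_add simp: subspace_add)
  then show "x + y \<in> closure S" by (auto simp: closure_sequential)
next
  fix k x assume "x \<in> closure S"
  then obtain X where X: "\<forall>n. X n \<in> S" "X \<longlonglongrightarrow> x"
    unfolding closure_sequential by blast
  have "bounded_linear (smul k)"
  proof (rule bounded_linear_intro)
    show "smul k (t *\<^sub>R v) = t *\<^sub>R smul k v" for t v
      by (simp add: mult.commute flip: smul_of_real)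
    show "norm (smul k v) \<le> norm v * norm k" for v
      by (simp add: norm_smul)
  qed (rule scale_right_distrib)
  then have "(\<lambda>n. smul k (X n)) \<longlonglongrightarrow> smul k x"
    using X(2) by (rule bounded_linear.tendsto)
  moreover have "\<forall>n. smul k (X n) \<in> S"
    using X(1) assms by (auto simp: subspace_scale)
  ultimately show "smul k x \<in> closure S"
    unfolding closure_sequential by (intro exI[of _ "\<lambda>n. smul k (X n)"] conjI)
qed

lemma invariant_subspace_closed_span_orbit:
  assumes T: "bounded_linear_over smul smul T"
  shows "invariant_subspace smul T (closed_span smul (orbit T v))"
proof -
  have lin: "Vector_Spaces.linear smul smul T" and bl: "bounded_linear T"
    using T by (auto simp: bounded_linear_over_def)
  have "T w \<in> orbit T v" if "w \<in> orbit T v" for w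
    using that by (auto simp: orbit_def) (metis funpow.simps(2) o_apply)
  then have "T ` span (orbit T v) \<subseteq> span (orbit T v)"
    using module_hom.span_image[OF lin[folded module_hom_iff_linear]] span_mono by (metis image_subsetI)
  then have "T ` closure (span (orbit T v)) \<subseteq> closure (span (orbit T v))"
    using closure_bounded_linear_image_subset[OF bl] closure_mono by blast
  then show ?thesis
    by (simp add: invariant_subspace_def closed_span_def subspace_closure)
qed

lemma dual_space_comp_funpow:
  assumes T: "bounded_linear_over smul smul T" and f: "f \<in> dual_space smul"
  shows "(\<lambda>x. f ((T ^^ k) x)) \<in> dual_space smul"
proof (induction k)
  case 0
  then show ?case using f by simp
next
  case (Suc k)
  let ?g = "\<lambda>x. f ((T ^^ k) x)"
  have T': "T (x + y) = T x + T y" "T (smul c x) = smul c (T x)" for x y c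
    using T by (auto simp: bounded_linear_over_def Vector_Spaces.linear_iff)
  have "bounded_linear (\<lambda>x. ?g (T x))"
    using T by (intro bounded_linear_compose[OF dual_spaceD(1)[OF Suc]])
      (simp add: bounded_linear_over_def)
  moreover have "Vector_Spaces.linear smul (*) (\<lambda>x. ?g (T x))"
    by (simp add: linear_scalar_iff T' dual_spaceD(2,4)[OF Suc])
  ultimately show ?case
    by (simp add: dual_space_def bounded_linear_over_def funpow_Suc_right del: funpow.simps)
qed

lemma dual_eq_0_on_closed_span:
  assumes f: "f \<in> dual_space smul" and S: "\<And>s. s \<in> S \<Longrightarrow> f s = 0"
    and x: "x \<in> closed_span smul S"
  shows "f x = 0"
proof -
  have "subspace {x. f x = 0}"
    using dual_spaceD(2,4)[OF f] linear_0[OF bounded_linear.linear[OF dual_spaceD(1)[OF f]]]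
    by (auto intro!: subspaceI)
  then have "span S \<subseteq> {x. f x = 0}"
    by (intro span_minimal) (use S in auto)
  moreover have "closed {x. f x = 0}"
    using bounded_linear.continuous_on[OF dual_spaceD(1)[OF f] continuous_on_id]
    by (intro closed_Collect_eq continuous_on_const) auto
  ultimately have "closure (span S) \<subseteq> {x. f x = 0}"
    by (rule closure_minimal)
  then show ?thesis using x by (auto simp: closed_span_def)
qed

end

theorem theorem3p3:
  fixes smul :: "'k::real_or_complex \<Rightarrow> 'a::banach \<Rightarrow> 'a"
    and T :: "'a \<Rightarrow> 'a" and A :: "'a set" and c :: 'a and r :: real
  assumes "banach_space_over smul"
    and "reflexive smul"
    and "dim_gt_one smul"
    and "bounded_linear_over smul smul T"
    and "0 < r" and "A = cball c r"
  shows "(\<exists>v\<in>A. T v = 0) \<or>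
         (\<exists>v\<in>A. nontrivial_invariant_subspace smul T (closed_span smul (orbit T (T v)))) \<or>
         (\<forall>x :: nat \<Rightarrow> 'a. (\<forall>n\<ge>1. x n \<in> A) \<longrightarrow>
            A \<subseteq> closed_span smul {(T ^^ k) (x l) | k l. 1 \<le> k \<and> k \<le> l})"
proof -
  interpret banach_space_over smul by fact
  note T = \<open>bounded_linear_over smul smul T\<close>
  have "A \<subseteq> closed_span smul {(T ^^ k) (x l) | k l. 1 \<le> k \<and> k \<le> l}"
    if nonzero: "\<And>v. v \<in> A \<Longrightarrow> T v \<noteq> 0"
      and trivial: "\<And>v. v \<in> A \<Longrightarrow>
        \<not> nontrivial_invariant_subspace smul T (closed_span smul (orbit T (T v)))"
      and x: "\<forall>n\<ge>1. x n \<in> A" for x :: "nat \<Rightarrow> 'a"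
  proof (rule ccontr)
    define S where "S = {(T ^^ k) (x l) | k l. 1 \<le> k \<and> k \<le> l}"
    assume "\<not> ?thesis"
    then obtain z where "z \<notin> closure (span S)"
      by (auto simp: closed_span_def S_def)
    then obtain f where f: "f \<in> dual_space smul" "\<And>s. s \<in> span S \<Longrightarrow> f s = 0" "f z \<noteq> 0"
      using separating_functional[OF subspace_span] by metis
    have "eventually (\<lambda>n. x n \<in> cball c r) sequentially"
      using x \<open>A = cball c r\<close> by (auto simp: eventually_sequentially)
    then obtain G y where G: "G \<noteq> bot" "G \<le> sequentially" and y: "y \<in> A"
      and weak: "\<And>g. g \<in> dual_space smul \<Longrightarrow> ((\<lambda>n. g (x n)) \<longlongrightarrow> g y) G"
      using weak_cluster_point[OF \<open>reflexive smul\<close>] \<open>A = cball c r\<close> by metis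
    have vanish: "f ((T ^^ k) y) = 0" if "1 \<le> k" for k
    proof -
      have "eventually (\<lambda>l. f ((T ^^ k) (x l)) = 0) sequentially"
        using eventually_ge_at_top[of k]
      proof eventually_elim
        case (elim l)
        then have "(T ^^ k) (x l) \<in> S" using that by (auto simp: S_def)
        then show ?case by (intro f span_base)
      qed
      then have "((\<lambda>l. f ((T ^^ k) (x l))) \<longlongrightarrow> 0) G"
        using filter_leD[OF G(2)] tendsto_eventually by metis
      then show ?thesis
        using tendsto_unique[OF G(1) weak[OF dual_space_comp_funpow[OF T f(1)]]] by blast
    qed
    have "closed_span smul (orbit T (T y)) = UNIV"
    proof -
      have "T y \<in> orbit T (T y)"
        unfolding orbit_def by (intro CollectI exI[of _ 0]) simp
      then have "T y \<in> closed_span smul (orbit T (T y))"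
        unfolding closed_span_def using span_base closure_subset by blast
      moreover have inv: "invariant_subspace smul T (closed_span smul (orbit T (T y)))"
        by (rule invariant_subspace_closed_span_orbit[OF T])
      moreover from inv have "0 \<in> closed_span smul (orbit T (T y))"
        by (simp add: invariant_subspace_def subspace_0)
      ultimately show ?thesis
        using trivial[OF y] nonzero[OF y] unfolding nontrivial_invariant_subspace_def by blast
    qed
    moreover have "f w = 0" if "w \<in> orbit T (T y)" for w
    proof -
      obtain n where "w = (T ^^ n) (T y)"
        using \<open>w \<in> orbit T (T y)\<close> by (auto simp: orbit_def)
      then have "w = (T ^^ Suc n) y"
        by (simp add: funpow_swap1)
      then show ?thesis using vanish[of "Suc n"] by simp
    qed
    ultimately have "f z = 0"
      using dual_eq_0_on_closed_span[OF f(1)] by blast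
    with f(3) show False ..
  qed
  then show ?thesis by blast
qed

end
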